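(* Let $\Pi$ be a probability measure on $[0,1]$ (the prior on the basin size $s$) that admits a density $f_s$, and suppose there exist constants $c>0$, $\delta\in(0,1)$ and $\kappa\ge 0$ such that $f_s(s)\ge c(1-s)^{\kappa}$ for all $s\in(1-\delta,1)$. Then for every $\varepsilon\in(0,1)$ and every integer $n\ge 2$ with $1/n<\delta$, $$\Pi(A_\varepsilon\mid H_n)\le \frac{4(\kappa+1)}{c}\,n^{\kappa+1}(1-\varepsilon)^{n}\,\Pi(A_\varepsilon)\le \frac{4(\kappa+1)}{c}\,n^{\kappa+1}e^{-n\varepsilon}\,\Pi(A_\varepsilon).$$
   Context: For $\varepsilon\in(0,1)$, $A_\varepsilon:=\{s\in[0,1]: s\le 1-\varepsilon\}$. $H_n$ is the event that $n$ runs, conditionally independent given $s$ and each reaching a fixed outcome with probability $s$, all reach that outcome; its likelihood is $\mathbb P(H_n\mid s)=s^n$. The posterior is $\Pi(A\mid H_n)=\int_A s^n\,d\Pi(s)\big/\int_{[0,1]} s^n\,d\Pi(s)$ for Borel $A\subseteq[0,1]$. *)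

theory Defs
  imports "HOL-Probability.Probability"
begin

definition A_eps :: "real \<Rightarrow> real set" where
  "A_eps \<epsilon> = {s \<in> {0..1}. s \<le> 1 - \<epsilon>}"

definition likelihood :: "nat \<Rightarrow> real \<Rightarrow> real" where
  "likelihood n s = s ^ n"

text \<open>The likelihood is that of the event that \<open>n\<close> independent runs, each succeeding with
  probability \<open>s\<close>, all succeed.\<close>

lemma prob_all_runs_eq_likelihood:
  assumes "0 \<le> s" "s \<le> 1"
  shows "measure_pmf.prob (Pi_pmf {..<n} dflt (\<lambda>_. bernoulli_pmf s)) {\<omega>. \<forall>i<n. \<omega> i}
           = likelihood n s"
proof -
  have "{\<omega>. \<forall>i<n. \<omega> i} = Pi {..<n} (\<lambda>_. {True})"
    by (auto simp: Pi_def)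
  then show ?thesis
    using assms by (simp add: measure_Pi_pmf_Pi measure_pmf_single likelihood_def)
qed

definition posterior :: "real measure \<Rightarrow> nat \<Rightarrow> real set \<Rightarrow> real" where
  "posterior \<mu> n A =
     (LINT s:A|\<mu>. likelihood n s) / (LINT s:{0..1}|\<mu>. likelihood n s)"

end

theory Submission imports Defs begin

text \<open>On \<open>A_eps \<epsilon>\<close> the likelihood is at most \<open>(1 - \<epsilon>) ^ n\<close>, which bounds the numerator of the
  posterior. Restricting its denominator to \<open>{1 - 1/n..1}\<close>, where the likelihood is at least
  \<open>(1 - 1/n) ^ n \<ge> 1/4\<close> and the density at least \<open>c * (1 - s) powr \<kappa>\<close>, bounds it from below by
  \<open>c / (4 * (\<kappa> + 1) * n powr (\<kappa> + 1))\<close>.\<close>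

text \<open>The constant is attained at \<open>n = 2\<close>, while \<open>n = 1\<close> gives 0.
  The power is split as a square of the half power, with one extra factor \<open>1 - 1 / n\<close>
  when \<open>n\<close> is odd.\<close>

lemma one_minus_inverse_power_ge_quarter:
  fixes n :: nat
  assumes "n \<ge> 2"
  shows "(1 - 1 / real n) ^ n \<ge> 1 / 4"
proof -
  define x where "x = 1 - 1 / real n"
  \<comment> \<open>Bernoulli with exponent \<open>n\<close> only gives 0; applied to the half power it is strong enough.\<close>
  define m where "m = n div 2"
  have m: "m \<ge> 1" using assms by (simp add: m_def)
  have x: "x \<ge> 0" using assms by (simp add: x_def)
  have "1 + real m * (- (1 / real n)) \<le> (1 + - (1 / real n)) ^ m"
    using assms by (intro Bernoulli_inequality) simp
  then have bern: "1 - real m / real n \<le> x ^ m"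
    by (simp add: x_def)
  show ?thesis
  proof (cases "even n")
    case True
    then have n: "n = 2 * m" by (simp add: m_def)
    have "1 / 2 \<le> x ^ m" using bern m by (simp add: n)
    then have "(1 / 2)\<^sup>2 \<le> (x ^ m)\<^sup>2" by (intro power_mono) simp_all
    also have "(x ^ m)\<^sup>2 = x ^ n" by (simp add: n power_mult [symmetric] mult.commute)
    finally show ?thesis by (simp add: x_def power2_eq_square)
  next
    case False
    then have n: "n = 2 * m + 1" by (simp add: m_def)
    \<comment> \<open>The unpaired factor \<open>x = 2 * m / (2 * m + 1)\<close> is below 1, but
      \<open>1 - m / n = (m + 1) / (2 * m + 1)\<close> exceeds 1/2 by enough to compensate.\<close>
    have eq: "x * (1 - real m / real n)\<^sup>2 = 2 * m * (m + 1)\<^sup>2 / (2 * real m + 1) ^ 3"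
      by (simp add: x_def n field_simps power2_eq_square power3_eq_cube)
    have "1 / 4 \<le> x * (1 - real m / real n)\<^sup>2"
    proof -
      have "(2 * real m + 1) ^ 3 \<le> 4 * (2 * m * (m + 1)\<^sup>2)"
      proof -
        \<comment> \<open>The cubic terms cancel in the difference below; this bound on the square
          makes its positivity a linear problem.\<close>
        have "real m \<le> real m * real m" using m by simp
        moreover have "4 * (2 * m * (m + 1)\<^sup>2) - (2 * real m + 1) ^ 3
            = 4 * (real m * real m) + 2 * real m - 1"
          by (simp add: field_simps power2_eq_square power3_eq_cube)
        moreover have "real m \<ge> 1" using m by simp
        ultimately show ?thesis by linarith
      qed
      then show ?thesis unfolding eq by (simp add: field_simps)
    qed
    also have "\<dots> \<le> x * (x ^ m)\<^sup>2"
      using bern x by (intro mult_left_mono power_mono) (simp_all add: n)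
    also have "\<dots> = x ^ n"
      by (simp add: n power_mult [symmetric] mult.commute)
    finally show ?thesis by (simp add: x_def)
  qed
qed

text \<open>The antiderivative is \<open>- ((1 - s) powr (a + 1) / (a + 1))\<close>. The base
  vanishes at \<open>s = 1\<close>, where the derivative rule for \<open>powr\<close> does not
  apply, so the interior form of the fundamental theorem is used: at the endpoints it asks only for
  continuity.\<close>

lemma has_integral_one_minus_powr:
  fixes a h :: real
  assumes "a \<ge> 0" "h \<ge> 0"
  shows "((\<lambda>s. (1 - s) powr a) has_integral (h powr (a + 1) / (a + 1))) {1 - h..1}"
proof -
  have "((\<lambda>s. (1 - s) powr a) has_integral
      (- ((1 - 1) powr (a + 1) / (a + 1)) - (- ((1 - (1 - h)) powr (a + 1) / (a + 1))))) {1 - h..1}"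
  proof (rule fundamental_theorem_of_calculus_interior)
    show "continuous_on {1 - h..1} (\<lambda>s. - ((1 - s) powr (a + 1) / (a + 1)))"
      using assms by (intro continuous_intros continuous_on_powr') auto
    show "((\<lambda>s. - ((1 - s) powr (a + 1) / (a + 1))) has_vector_derivative (1 - s) powr a) (at s)"
      if "s \<in> {1 - h<..<1}" for s
      unfolding has_real_derivative_iff_has_vector_derivative [symmetric]
      using that assms by (auto intro!: derivative_eq_intros simp: divide_simps)
  qed (use assms in simp)
  then show ?thesis by simp
qed

text \<open>The pointwise comparison on the window \<open>{1 - h..1}\<close> is integrated as a
  nonnegative integral over \<open>lborel\<close>, so integrability of \<open>f s * s ^ n\<close>
  need not be established first; the result is then carried back to the Bochner integral.\<close>

lemma evidence_lower_bound:
  fixes f :: "real \<Rightarrow> real" and c h a :: real and n :: nat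
  defines "\<mu> \<equiv> density (restrict_space lborel {0..1}) (\<lambda>s. ennreal (f s))"
  assumes "prob_space \<mu>"
    and f_measurable: "f \<in> borel_measurable (restrict_space lborel {0..1})"
    and c: "c \<ge> 0" and a: "a \<ge> 0" and h: "0 \<le> h" "h \<le> 1"
    and lower: "\<And>s. s \<in> {1 - h..<1} \<Longrightarrow> f s \<ge> c * (1 - s) powr a"
  shows "(LINT s:{0..1}|\<mu>. s ^ n) \<ge> (1 - h) ^ n * c * (h powr (a + 1) / (a + 1))"
proof -
  interpret prob_space \<mu> by fact
  define C where "C = (1 - h) ^ n * c"
  have C: "C \<ge> 0" using c h by (simp add: C_def)
  have space: "space \<mu> = {0..1}" by (simp add: \<mu>_def space_restrict_space)
  have sets: "sets \<mu> = sets (restrict_space borel {0..1})"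
    by (simp add: \<mu>_def sets_restrict_space)
  have meas: "(\<lambda>s. s ^ n) \<in> borel_measurable \<mu>"
    unfolding measurable_cong_sets [OF sets refl]
    by (intro measurable_restrict_space1) simp
  have int: "integrable \<mu> (\<lambda>s. s ^ n)"
    using meas by (intro integrable_const_bound [where B = 1]) (auto simp: space power_le_one)
  have LINT: "(LINT s:{0..1}|\<mu>. s ^ n) = (LINT s|\<mu>. s ^ n)"
    using set_integral_space [OF int] by (simp add: space)
  have "((\<lambda>s. C * (1 - s) powr a) has_integral C * (h powr (a + 1) / (a + 1))) {1 - h..1}"
    using has_integral_one_minus_powr [OF a h(1)] by (rule has_integral_mult_right)
  then have "ennreal (C * (h powr (a + 1) / (a + 1)))
      = (\<integral>\<^sup>+s. ennreal (C * (1 - s) powr a) * indicator {1 - h..1} s \<partial>lborel)"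
    using C by (intro nn_integral_has_integral_lebesgue' [symmetric]) auto
  also have "\<dots> \<le> (\<integral>\<^sup>+s. ennreal (f s) * ennreal (s ^ n) * indicator {0..1} s \<partial>lborel)"
  proof (intro nn_integral_mono)
    fix s :: real
    \<comment> \<open>The point 1 is separate because \<open>lower\<close> stops short of it. There
      the left side is 0, since \<open>0 powr a = 0\<close> in HOL even for
      \<open>a = 0\<close>.\<close>
    consider "s \<notin> {1 - h..1}" | "s = 1" | "s \<in> {1 - h..<1}" by fastforce
    then show "ennreal (C * (1 - s) powr a) * indicator {1 - h..1} s
        \<le> ennreal (f s) * ennreal (s ^ n) * indicator {0..1} s"
    proof cases
      case 3
      have "C * (1 - s) powr a = (c * (1 - s) powr a) * (1 - h) ^ n" by (simp add: C_def)
      \<comment> \<open>Monotonicity of the product needs \<open>0 \<le> f s\<close>, which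
        \<open>lower\<close> yields because its left side is nonnegative.\<close>
      also have "\<dots> \<le> f s * s ^ n"
        using 3 c h lower [OF 3] by (intro mult_mono power_mono order_trans [OF _ lower [OF 3]]) auto
      finally show ?thesis
        using 3 h by (simp add: ennreal_leI ennreal_mult'' [symmetric])
    qed simp_all
  qed
  also have "\<dots> = (\<integral>\<^sup>+s. ennreal (f s) * ennreal (s ^ n) \<partial>restrict_space lborel {0..1})"
    by (subst nn_integral_restrict_space) simp_all
  also have "\<dots> = (\<integral>\<^sup>+s. ennreal (s ^ n) \<partial>\<mu>)"
  proof -
    have "(\<lambda>s. s ^ n) \<in> borel_measurable (restrict_space lborel {0..1::real})"
      by (intro measurable_restrict_space1) simp
    then show ?thesis
      unfolding \<mu>_def using f_measurable by (subst nn_integral_density) auto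
  qed
  also have "\<dots> = ennreal (LINT s|\<mu>. s ^ n)"
    using int by (intro nn_integral_eq_integral) (auto simp: space)
  finally have "C * (h powr (a + 1) / (a + 1)) \<le> (LINT s|\<mu>. s ^ n)"
    by (subst (asm) ennreal_le_iff) (auto intro!: integral_nonneg_AE simp: space)
  then show ?thesis by (simp add: C_def LINT)
qed

theorem proposition5p3:
  fixes \<mu> :: "real measure" and f :: "real \<Rightarrow> real"
    and c \<delta> \<kappa> \<epsilon> :: real and n :: nat
  assumes prior: "prob_space \<mu>" "sets \<mu> = sets (restrict_space borel {0..1})"
    and f_measurable: "f \<in> borel_measurable (restrict_space lborel {0..1})"
    and f_nonneg: "\<And>s. s \<in> {0..1} \<Longrightarrow> 0 \<le> f s"
    and f_density: "\<mu> = density (restrict_space lborel {0..1}) (\<lambda>s. ennreal (f s))"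
    and c: "c > 0" and \<delta>: "\<delta> \<in> {0<..<1}" and \<kappa>: "\<kappa> \<ge> 0"
    and lower: "\<And>s. s \<in> {1 - \<delta><..<1} \<Longrightarrow> f s \<ge> c * (1 - s) powr \<kappa>"
    and \<epsilon>: "\<epsilon> \<in> {0<..<1}"
    and n: "n \<ge> 2" "1 / real n < \<delta>"
  shows "posterior \<mu> n (A_eps \<epsilon>)
           \<le> 4 * (\<kappa> + 1) / c * real n powr (\<kappa> + 1) * (1 - \<epsilon>) ^ n * measure \<mu> (A_eps \<epsilon>)
       \<and> 4 * (\<kappa> + 1) / c * real n powr (\<kappa> + 1) * (1 - \<epsilon>) ^ n * measure \<mu> (A_eps \<epsilon>)
           \<le> 4 * (\<kappa> + 1) / c * real n powr (\<kappa> + 1) * exp (- (real n * \<epsilon>)) * measure \<mu> (A_eps \<epsilon>)"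
proof -
  interpret prob_space \<mu> by fact
  define B where "B = 4 * (\<kappa> + 1) / c * real n powr (\<kappa> + 1)"
  define N where "N = (LINT s:A_eps \<epsilon>|\<mu>. s ^ n)"
  define D where "D = (LINT s:{0..1}|\<mu>. s ^ n)"
  have B: "B > 0" using c \<kappa> n by (simp add: B_def)
  have space: "space \<mu> = {0..1}"
    using sets_eq_imp_space_eq [OF prior(2)] by (simp add: space_restrict_space)
  have A_eq: "A_eps \<epsilon> = {0..1 - \<epsilon>}" using \<epsilon> by (auto simp: A_eps_def)
  have A: "A_eps \<epsilon> \<in> sets \<mu>"
    using \<epsilon> unfolding prior(2) A_eq by (subst sets_restrict_space_iff) auto
  have meas: "(\<lambda>s. s ^ n) \<in> borel_measurable \<mu>"
    unfolding measurable_cong_sets [OF prior(2) refl]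
    by (intro measurable_restrict_space1) simp
  have int: "integrable \<mu> (\<lambda>s. s ^ n)"
    using meas by (intro integrable_const_bound [where B = 1]) (auto simp: space power_le_one)
  have N: "N \<le> (1 - \<epsilon>) ^ n * measure \<mu> (A_eps \<epsilon>)"
  proof -
    have "N \<le> (LINT s:A_eps \<epsilon>|\<mu>. (1 - \<epsilon>) ^ n)"
      unfolding N_def
    proof (rule set_integral_mono)
      show "set_integrable \<mu> (A_eps \<epsilon>) (\<lambda>s. s ^ n)"
        using int A unfolding set_integrable_def
        by (intro integrable_mult_indicator)
      show "set_integrable \<mu> (A_eps \<epsilon>) (\<lambda>s. (1 - \<epsilon>) ^ n)"
        using A unfolding set_integrable_def
        by (intro integrable_mult_indicator) auto
    qed (auto simp: A_eq intro: power_mono)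
    also have "\<dots> = (1 - \<epsilon>) ^ n * measure \<mu> (A_eps \<epsilon>)"
      using A by (simp add: set_lebesgue_integral_def)
    finally show ?thesis .
  qed
  \<comment> \<open>The window width is \<open>h = 1 / n\<close>: it keeps
    \<open>(1 - h) ^ n\<close> above a constant, and \<open>h powr (\<kappa> + 1)\<close> costs only
    a polynomial factor in \<open>n\<close>.\<close>
  have "1 / B = 1 / 4 * c * ((1 / real n) powr (\<kappa> + 1) / (\<kappa> + 1))"
    using c \<kappa> n by (simp add: B_def powr_divide field_simps)
  also have "\<dots> \<le> (1 - 1 / real n) ^ n * c * ((1 / real n) powr (\<kappa> + 1) / (\<kappa> + 1))"
    using one_minus_inverse_power_ge_quarter [OF n(1)] c \<kappa>
    by (intro mult_right_mono) auto
  \<comment> \<open>As \<open>1 / n < \<delta>\<close> is strict, the closed left end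
    \<open>1 - 1 / n\<close> of the window lies in the open interval where the density bound
    holds.\<close>
  also have "\<dots> \<le> D"
    unfolding D_def f_density
    using prior(1) f_measurable c \<kappa> n \<delta>
    by (intro evidence_lower_bound lower) (auto simp flip: f_density)
  finally have D: "1 / B \<le> D" .
  have "posterior \<mu> n (A_eps \<epsilon>) = N / D"
    by (simp add: posterior_def likelihood_def N_def D_def)
  \<comment> \<open>Positivity of \<open>1 / B\<close> keeps the evidence \<open>D\<close> away from
    0, so the quotient is not the default value of a division by 0.\<close>
  also have "\<dots> \<le> ((1 - \<epsilon>) ^ n * measure \<mu> (A_eps \<epsilon>)) / (1 / B)"
    using N D B \<epsilon> by (intro frac_le) auto
  finally have "posterior \<mu> n (A_eps \<epsilon>) \<le> B * (1 - \<epsilon>) ^ n * measure \<mu> (A_eps \<epsilon>)"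
    by (simp add: mult_ac)
  moreover have "(1 - \<epsilon>) ^ n \<le> exp (- (real n * \<epsilon>))"
  proof -
    have "(1 - \<epsilon>) ^ n \<le> exp (- \<epsilon>) ^ n"
      using \<epsilon> exp_ge_add_one_self [of "- \<epsilon>"] by (intro power_mono) auto
    then show ?thesis by (simp add: exp_of_nat_mult [symmetric])
  qed
  then have "B * (1 - \<epsilon>) ^ n * measure \<mu> (A_eps \<epsilon>)
      \<le> B * exp (- (real n * \<epsilon>)) * measure \<mu> (A_eps \<epsilon>)"
    using B by (intro mult_right_mono mult_left_mono) auto
  ultimately show ?thesis by (simp add: B_def)
qed

end
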